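(* For each $n\ge 5$ let $f_n$ be the number of permutations $\pi\in S_n^1(1\text{-}2\text{-}3)$ for which $(1\text{-}23)\pi=0$ and $(12\text{-}3)\pi=0$, i.e. the permutations of length $n$ that contain exactly one occurrence of the pattern $(1\text{-}2\text{-}3)$, no occurrence of the pattern $(1\text{-}23)$, and no occurrence of the pattern $(12\text{-}3)$. Then, as formal power series, $$\sum_{n\ge 5} f_n x^n = x^5 C(x)^8=\sum_{n\ge 5}\frac{8}{n+3}\binom{2n-3}{n+2}x^n.$$
   Context: Let $\pi=\pi_1\pi_2\cdots\pi_n$ be a permutation of $\{1,\ldots,n\}$. An occurrence of the pattern $(1\text{-}2\text{-}3)$ in $\pi$ is a triple of positions $i<j<m$ with $\pi_i<\pi_j<\pi_m$. An occurrence of the pattern $(1\text{-}23)$ is such a triple in which the last two positions are adjacent, i.e. $m=j+1$; an occurrence of the pattern $(12\text{-}3)$ is such a triple in which the first two positions are adjacent, i.e. $j=i+1$. For a pattern $q$, $(q)\pi$ denotes the number of occurrences of $q$ in $\pi$, and $S_n^k(q)$ denotes the set of permutations of length $n$ containing exactly $k$ occurrences of $q$. $C(x)=\frac{1-\sqrt{1-4x}}{2x}=\sum_{n\ge 0}\frac{1}{n+1}\binom{2n}{n}x^n$ is the Catalan generating function. *)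

theory Defs
  imports
    Complex_Main
    "HOL-Combinatorics.Permutations"
    "HOL-Computational_Algebra.Formal_Power_Series"
begin

text \<open>
  A permutation \<open>\<pi>\<^sub>1 \<dots> \<pi>\<^sub>n\<close> of \<open>{1..n}\<close> is a function \<open>\<pi>\<close> with \<open>\<pi> permutes {1..n}\<close>; this predicate
  makes \<open>\<pi>\<close> the identity outside \<open>{1..n}\<close>, so each permutation is represented exactly once.
\<close>

definition occ_1_2_3 :: "nat \<Rightarrow> (nat \<Rightarrow> nat) \<Rightarrow> (nat \<times> nat \<times> nat) set" where
  "occ_1_2_3 n \<pi> = {(i, j, m). i \<in> {1..n} \<and> j \<in> {1..n} \<and> m \<in> {1..n} \<and>
     i < j \<and> j < m \<and> \<pi> i < \<pi> j \<and> \<pi> j < \<pi> m}"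

definition occ_1_23 :: "nat \<Rightarrow> (nat \<Rightarrow> nat) \<Rightarrow> (nat \<times> nat \<times> nat) set" where
  "occ_1_23 n \<pi> = {(i, j, m) \<in> occ_1_2_3 n \<pi>. m = j + 1}"

definition occ_12_3 :: "nat \<Rightarrow> (nat \<Rightarrow> nat) \<Rightarrow> (nat \<times> nat \<times> nat) set" where
  "occ_12_3 n \<pi> = {(i, j, m) \<in> occ_1_2_3 n \<pi>. j = i + 1}"

text \<open>
  A pattern is passed as the function that maps \<open>n\<close> and \<open>\<pi>\<close> to the set of its occurrences;
  \<open>perms_with n k occ\<close> is then \<open>S\<^sub>n\<^sup>k(q)\<close>.
\<close>

definition perms_with ::
  "nat \<Rightarrow> nat \<Rightarrow> (nat \<Rightarrow> (nat \<Rightarrow> nat) \<Rightarrow> (nat \<times> nat \<times> nat) set) \<Rightarrow> (nat \<Rightarrow> nat) set" where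
  "perms_with n k occ = {\<pi>. \<pi> permutes {1..n} \<and> card (occ n \<pi>) = k}"

definition f_num :: "nat \<Rightarrow> nat" where
  "f_num n = card {\<pi> \<in> perms_with n 1 occ_1_2_3.
     card (occ_1_23 n \<pi>) = 0 \<and> card (occ_12_3 n \<pi>) = 0}"

lemma finite_occ:
  "finite (occ_1_2_3 n \<pi>)" "finite (occ_1_23 n \<pi>)" "finite (occ_12_3 n \<pi>)"
proof -
  have "occ_1_2_3 n \<pi> \<subseteq> {1..n} \<times> {1..n} \<times> {1..n}"
    by (auto simp: occ_1_2_3_def)
  then show 1: "finite (occ_1_2_3 n \<pi>)"
    by (rule finite_subset) auto
  show "finite (occ_1_23 n \<pi>)"
    by (rule finite_subset[OF _ 1]) (auto simp: occ_1_23_def)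
  show "finite (occ_12_3 n \<pi>)"
    by (rule finite_subset[OF _ 1]) (auto simp: occ_12_3_def)
qed

definition catalan_fps :: "real fps" where
  "catalan_fps = Abs_fps (\<lambda>n. 1 / (real n + 1) * real ((2 * n) choose n))"

lemma central_binomial_Suc:
  "(real n + 1) * real ((2 * Suc n) choose Suc n) = 2 * (2 * real n + 1) * real ((2 * n) choose n)"
proof -
  have 1: "Suc n * ((2 * Suc n) choose Suc n) = (2 * Suc n) * (Suc (2 * n) choose n)"
    using Suc_times_binomial_eq[of "Suc (2 * n)" n] by simp
  have 2: "Suc n * (Suc (2 * n) choose n) = Suc (2 * n) * ((2 * n) choose n)"
    using binomial_absorb_comp[of "Suc (2 * n)" n] by (simp add: Suc_diff_le mult_2)
  have "Suc n * (Suc n * ((2 * Suc n) choose Suc n))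
      = Suc n * (2 * Suc (2 * n) * ((2 * n) choose n))"
    using 1 2 by (metis (no_types, lifting) mult.assoc mult.commute)
  then have "Suc n * ((2 * Suc n) choose Suc n) = 2 * Suc (2 * n) * ((2 * n) choose n)"
    by (metis Suc_neq_Zero mult_cancel1)
  then have "real (Suc n * ((2 * Suc n) choose Suc n)) = real (2 * Suc (2 * n) * ((2 * n) choose n))"
    by presburger
  then show ?thesis
    by (simp add: algebra_simps)
qed

lemma gbinomial_half_Suc:
  "((1 / 2 :: real) gchoose Suc n) * (- 4) ^ Suc n = - 2 * (1 / (real n + 1) * real ((2 * n) choose n))"
proof (induction n)
  case 0
  show ?case by simp
next
  case (Suc n)
  let ?c = "real ((2 * n) choose n)"
  have "((1 / 2 :: real) gchoose Suc (Suc n)) = (1 / 2 gchoose Suc n) * (1 / 2 - real (Suc n)) / real (Suc (Suc n))"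
    using gbinomial_mult_1[of "1 / 2 :: real" "Suc n"] by (simp add: field_simps)
  then have "((1 / 2 :: real) gchoose Suc (Suc n)) * (- 4) ^ Suc (Suc n)
     = ((1 / 2 gchoose Suc n) * (- 4) ^ Suc n) * (- 4 * (1 / 2 - real (Suc n)) / real (Suc (Suc n)))"
    unfolding power_Suc[of "- 4" "Suc n"] by (simp only: times_divide_eq_left times_divide_eq_right mult_ac)
  also have "\<dots> = - 2 * (1 / (real n + 1) * ?c) * (2 * (2 * real n + 1) / (real n + 2))"
  proof -
    have "- 4 * (1 / 2 - real (Suc n)) / real (Suc (Suc n)) = 2 * (2 * real n + 1) / (real n + 2)"
      by (rule arg_cong2[of _ _ _ _ "(/)"]) auto
    then show ?thesis unfolding Suc.IH by (rule arg_cong)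
  qed
  also have "\<dots> = - 2 * (1 / (real (Suc n) + 1)) * (2 * (2 * real n + 1) * ?c / (real n + 1))"
    by (simp add: add.commute mult.commute)
  also have "2 * (2 * real n + 1) * ?c / (real n + 1) = real ((2 * Suc n) choose Suc n)"
    unfolding central_binomial_Suc[symmetric] by simp
  finally show ?case by (simp only: mult.assoc)
qed

lemma catalan_fps_closed_form:
  "catalan_fps = (1 - fps_radical root 2 (1 - 4 * fps_X)) / (2 * fps_X)"
proof -
  define T where "T = fps_binomial (1 / 2 :: real) oo (fps_const (- 4) * fps_X)"
  have "T ^ 2 = (fps_binomial (1 / 2) * fps_binomial (1 / 2)) oo (fps_const (- 4) * fps_X)"
    unfolding T_def power2_eq_square by (rule fps_compose_mult_distrib[symmetric]) simp
  also have "fps_binomial (1 / 2 :: real) * fps_binomial (1 / 2) = 1 + fps_X"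
    using fps_binomial_of_nat[of 1, where 'a = real]
    by (simp flip: fps_binomial_add_mult)
  also have "(1 + fps_X) oo (fps_const (- 4) * fps_X) = 1 - 4 * (fps_X :: real fps)"
    by (simp add: fps_compose_add_distrib fps_numeral_fps_const flip: fps_const_neg)
  finally have sq: "T ^ Suc 1 = 1 - 4 * fps_X"
    by (simp add: numeral_2_eq_2)
  have "T = fps_radical root (Suc 1) (1 - 4 * fps_X)"
    by (rule iffD1[OF radical_unique sq]) (simp_all add: T_def)
  then have rad: "fps_radical root 2 (1 - 4 * fps_X) = T"
    by (simp add: numeral_2_eq_2)
  have "1 - T = (2 * fps_X) * catalan_fps"
  proof (rule fps_ext)
    fix n
    show "fps_nth (1 - T) n = fps_nth ((2 * fps_X) * catalan_fps) n"
    proof (cases n)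
      case 0
      then show ?thesis by (simp add: T_def mult.assoc)
    next
      case (Suc m)
      then show ?thesis
        using gbinomial_half_Suc[of m]
        by (simp add: T_def fps_compose_linear catalan_fps_def mult.assoc mult.commute[of "1 / 2 gchoose Suc m"] fps_numeral_fps_const)
    qed
  qed
  then show ?thesis
    unfolding rad by simp
qed

end

theory Submission
  imports Defs "HOL-Library.Sublist" "HOL-Combinatorics.Multiset_Permutations"
begin

text \<open>
  Burstein's idea: if \<open>(a, b, c)\<close> is the only occurrence of 1-2-3 in
  \<open>\<pi> = P a Q b R c T\<close>, then everything to the left of \<open>b\<close> except \<open>a\<close> is larger than \<open>b\<close>, and
  everything to the right of \<open>b\<close> except \<open>c\<close> is smaller. Hence \<open>\<pi>\<close> corresponds to the pair of
  words \<open>P b Q c\<close> and \<open>a R b T\<close>, arbitrary 1-2-3-avoiding arrangements of \<open>{b..n}\<close> and \<open>{1..b}\<close>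
  in which \<open>b\<close> is not the last and not the first letter, respectively. The two adjacency
  conditions say that \<open>Q\<close> and \<open>R\<close> are nonempty, which leaves \<open>C\<^sub>k - 2 C\<^sub>k\<^sub>-\<^sub>1\<close> words of length
  \<open>k \<ge> 2\<close> on either side, with generating function \<open>x\<^sup>3 C\<^sup>4\<close>. Since \<open>b\<close> is counted in both words,
  the total is \<open>(x\<^sup>3 C\<^sup>4)\<^sup>2 / x = x\<^sup>5 C\<^sup>8\<close>.

  That avoiders are counted by Catalan numbers follows by inserting the maximum: it may go to the
  front or directly behind any decreasing prefix, and the number of avoiders of length \<open>n\<close> whose
  first \<open>j\<close> letters decrease is the coefficient of \<open>x\<^sup>n\<^sup>-\<^sup>j\<close> in \<open>C\<^sup>j\<^sup>+\<^sup>1\<close>.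
\<close>

section \<open>Words without 1-2-3 and their two- and three-letter subsequences\<close>

text \<open>The alphabet is arbitrary because the two halves live on \<open>{b..n}\<close> and
  \<open>{1..b}\<close>. Letters are distinct, so an occurrence is determined by its values.\<close>

definition avoiders :: "nat set \<Rightarrow> nat list set" where
  "avoiders S = {xs \<in> permutations_of_set S. \<forall>x y z. x < y \<and> y < z \<longrightarrow> \<not> subseq [x, y, z] xs}"

text \<open>This refinement makes insertion of the maximum recursive. The length bound guarantees
  that \<open>take j xs\<close> really has \<open>j\<close> letters.\<close>

definition dec_avoiders :: "nat \<Rightarrow> nat set \<Rightarrow> nat list set" where
  "dec_avoiders j S = {xs \<in> avoiders S. j \<le> length xs \<and> sorted_wrt (>) (take j xs)}"

declare subseq_Cons2_iff [simp del]

lemma subseq_set_mono: "subseq xs ys \<Longrightarrow> set xs \<subseteq> set ys"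
  by (auto simp: subseq_conv_nths dest: in_set_nthsD)

lemma subseq2_setD: "subseq [x, y] A \<Longrightarrow> x \<in> set A \<and> y \<in> set A"
  by (drule subseq_set_mono) simp

lemma subseq3_setD: "subseq [x, y, z] A \<Longrightarrow> x \<in> set A \<and> y \<in> set A \<and> z \<in> set A"
  by (drule subseq_set_mono) simp

text \<open>Plain disjunctions replace the greedy conditional form of
  \<open>subseq_Cons2_iff\<close>, so that arguments about where letters fall become
  propositional.\<close>

lemma subseq2_Cons: "subseq [x, y] (a # B) \<longleftrightarrow> x = a \<and> y \<in> set B \<or> subseq [x, y] B"
  by (auto simp: subseq_Cons2_iff subseq_singleton_left dest: subseq2_setD)

lemma subseq3_Cons: "subseq [x, y, z] (a # B) \<longleftrightarrow> x = a \<and> subseq [y, z] B \<or> subseq [x, y, z] B"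
  using subseq_Cons'[of x "[y, z]" B] by (auto simp: subseq_Cons2_iff)

lemma subseq2_append:
  "subseq [x, y] (A @ B) \<longleftrightarrow> subseq [x, y] A \<or> x \<in> set A \<and> y \<in> set B \<or> subseq [x, y] B"
  by (induction A) (auto simp: subseq2_Cons)

lemma subseq3_append:
  "subseq [x, y, z] (A @ B) \<longleftrightarrow> subseq [x, y, z] A \<or> subseq [x, y] A \<and> z \<in> set B
     \<or> x \<in> set A \<and> subseq [y, z] B \<or> subseq [x, y, z] B"
  by (induction A) (auto simp: subseq3_Cons subseq2_Cons subseq2_append)

lemmas subseq_simps = subseq2_append subseq3_append subseq2_Cons subseq3_Cons

text \<open>Puts decrease into the language of subsequences; distinctness is what turns "not below"
  into "above".\<close>

lemma sorted_wrt_greater_iff: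
  "distinct P \<Longrightarrow> sorted_wrt (>) P \<longleftrightarrow> (\<forall>x y. x < y \<longrightarrow> \<not> subseq [x, y] (P :: nat list))"
proof (induction P)
  case (Cons a P)
  have "(\<forall>x y. x < y \<longrightarrow> \<not> subseq [x, y] (a # P)) \<longleftrightarrow>
      (\<forall>y\<in>set P. \<not> a < y) \<and> (\<forall>x y. x < y \<longrightarrow> \<not> subseq [x, y] P)"
    unfolding subseq2_Cons by blast
  also have "(\<forall>y\<in>set P. \<not> a < y) \<longleftrightarrow> (\<forall>y\<in>set P. a > y)"
    using Cons.prems by (auto simp: not_less le_less)
  finally show ?case using Cons by simp
qed simp

section \<open>Insertion of the maximum\<close>

lemma insert_in_permutations_of_set:
  "m \<notin> S \<Longrightarrow> P @ m # Q \<in> permutations_of_set (insert m S) \<longleftrightarrow> P @ Q \<in> permutations_of_set S"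
  by (auto simp: permutations_of_set_def insert_eq_iff)

text \<open>The maximum can only be the last letter of an occurrence, so the new occurrences are the
  ascending pairs of \<open>P\<close> completed by \<open>M\<close>.\<close>

lemma avoiders_insert_max:
  assumes "finite S" "\<forall>x\<in>S. x < M"
  shows "P @ M # Q \<in> avoiders (insert M S) \<longleftrightarrow> P @ Q \<in> avoiders S \<and> sorted_wrt (>) P"
proof (cases "P @ Q \<in> permutations_of_set S")
  case True
  then have *: "set P \<union> set Q = S" "distinct P" "set P \<inter> set Q = {}" "distinct Q"
    by (auto simp: permutations_of_set_def)
  have M: "M \<notin> S" using assms by blast
  have "P @ M # Q \<in> permutations_of_set (insert M S)"
    using True M by (simp add: insert_in_permutations_of_set)
  moreover have "(\<forall>x y z. x < y \<and> y < z \<longrightarrow> \<not> subseq [x, y, z] (P @ M # Q)) \<longleftrightarrow>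
     (\<forall>x y z. x < y \<and> y < z \<longrightarrow> \<not> subseq [x, y, z] (P @ Q)) \<and> (\<forall>x y. x < y \<longrightarrow> \<not> subseq [x, y] P)"
    (is "?l \<longleftrightarrow> ?r1 \<and> ?r2")
  proof (intro iffI conjI)
    assume l: ?l
    show ?r1 using l by (auto simp: subseq_simps)
    show ?r2
    proof (intro allI impI notI)
      fix x y assume "x < y" and xy: "subseq [x, y] P"
      have "y < M" using subseq2_setD[OF xy] * assms(2) by blast
      moreover have "subseq [x, y, M] (P @ M # Q)" using xy by (simp add: subseq3_append)
      ultimately show False using l \<open>x < y\<close> by blast
    qed
  next
    assume r: "?r1 \<and> ?r2"
    show ?l
    proof (intro allI impI notI)
      fix x y z assume xyz: "x < y \<and> y < z" and s: "subseq [x, y, z] (P @ M # Q)"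
      have less: "v < M" if "v \<in> set P \<union> set Q" for v using that assms(2) *(1) by blast
      have "x \<noteq> M" using subseq3_setD[OF s] xyz less[of z] by auto
      moreover have "y \<noteq> M" using subseq3_setD[OF s] xyz less[of z] by auto
      ultimately have "subseq [x, y, z] (P @ Q) \<or> subseq [x, y] P"
        using s unfolding subseq_simps by auto
      then show False using r xyz by blast
    qed
  qed
  ultimately show ?thesis
    using True sorted_wrt_greater_iff[OF *(2)] by (simp add: avoiders_def)
next
  case False
  have "M \<notin> S" using assms by blast
  then have "P @ M # Q \<notin> permutations_of_set (insert M S)"
    using False by (simp add: insert_in_permutations_of_set)
  with False show ?thesis by (simp add: avoiders_def)
qed

lemma length_avoiders: "xs \<in> avoiders S \<Longrightarrow> length xs = card S"
  by (auto simp: avoiders_def length_finite_permutations_of_set)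

lemma finite_avoiders [simp]: "finite (avoiders S)"
  by (rule finite_subset[of _ "permutations_of_set S"]) (auto simp: avoiders_def)

lemma finite_dec_avoiders [simp]: "finite (dec_avoiders j S)"
  by (rule finite_subset[of _ "avoiders S"]) (auto simp: dec_avoiders_def)

text \<open>Deleting \<open>M\<close> is inverted by insertion. In front, \<open>M\<close> needs
  \<open>j\<close> decreasing letters after it; behind \<open>p > 0\<close> letters it needs these
  to decrease, and \<open>p > j\<close>, since otherwise the ascent to \<open>M\<close> falls into
  the prefix.\<close>

lemma card_dec_avoiders_insert_max:
  assumes "finite S" "\<forall>x\<in>S. x < M"
  shows "card (dec_avoiders (Suc j) (insert M S)) = (\<Sum>p=j..card S. card (dec_avoiders p S))"
proof -
  \<comment> \<open>The index \<open>p = j\<close> is free to encode insertion at the front: inserting behind exactly \<open>j\<close>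
    letters would not leave \<open>Suc j\<close> decreasing ones.\<close>
  define h where "h = (\<lambda>(p, ys). if p = j then M # ys else take p ys @ M # drop p ys)"
  have M: "M \<notin> S" using assms by blast
  have nM: "M \<notin> set ys" if "ys \<in> dec_avoiders p S" for p ys
    using that M by (auto simp: dec_avoiders_def avoiders_def permutations_of_set_def)
  have "inj_on h (SIGMA p:{j..card S}. dec_avoiders p S)"
  proof (rule inj_onI, clarify)
    fix p ys q zs
    assume p: "p \<in> {j..card S}" "ys \<in> dec_avoiders p S" and q: "q \<in> {j..card S}" "zs \<in> dec_avoiders q S"
      and eq: "h (p, ys) = h (q, zs)"
    \<comment> \<open>The true number of letters in front of \<open>M\<close>, with the index
      \<open>j\<close> decoded to 0. As \<open>M\<close> is a new letter, the word determines this
      number.\<close>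
    define p' where "p' = (if p = j then 0 else p)"
    define q' where "q' = (if q = j then 0 else q)"
    have "take p' ys @ M # drop p' ys = take q' zs @ M # drop q' zs"
      using eq by (auto simp: h_def p'_def q'_def split: if_splits)
    moreover have "M \<notin> set (take p' ys)" "M \<notin> set (drop p' ys)" "M \<notin> set (take q' zs)"
      using nM[OF p(2)] nM[OF q(2)] by (auto dest: in_set_takeD in_set_dropD)
    ultimately have e: "take p' ys = take q' zs" "drop p' ys = drop q' zs"
      by (auto simp: append_eq_Cons_conv append_eq_append_conv2 Cons_eq_append_conv)
    have "length (take p' ys) = p'" "length (take q' zs) = q'"
      using p q by (auto simp: dec_avoiders_def p'_def q'_def)
    then have "p' = q'" using e by metis
    moreover have "ys = zs" using e by (metis append_take_drop_id)
    ultimately show "p = q \<and> ys = zs" using p q by (auto simp: p'_def q'_def split: if_splits)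
  qed
  moreover have "h ` (SIGMA p:{j..card S}. dec_avoiders p S) = dec_avoiders (Suc j) (insert M S)"
  proof (intro equalityI subsetI)
    fix xs assume "xs \<in> h ` (SIGMA p:{j..card S}. dec_avoiders p S)"
    then obtain p ys where p: "p \<in> {j..card S}" "ys \<in> dec_avoiders p S" and xs: "xs = h (p, ys)" by auto
    show "xs \<in> dec_avoiders (Suc j) (insert M S)"
    proof (cases "p = j")
      case True
      have "M # ys \<in> avoiders (insert M S)"
        using avoiders_insert_max[OF assms, of "[]" ys] p by (auto simp: dec_avoiders_def)
      moreover have "\<forall>x\<in>set (take j ys). x < M"
        using p assms(2) by (auto simp: dec_avoiders_def avoiders_def permutations_of_set_def dest: in_set_takeD)
      ultimately show ?thesis using p True by (auto simp: xs h_def dec_avoiders_def)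
    next
      case False
      have "take p ys @ M # drop p ys \<in> avoiders (insert M S)"
        using avoiders_insert_max[OF assms, of "take p ys" "drop p ys"] p by (auto simp: dec_avoiders_def)
      moreover have "take (Suc j) (take p ys @ M # drop p ys) = take (Suc j) (take p ys)"
        using p False by (auto simp: dec_avoiders_def)
      moreover have "sorted_wrt (>) (take (Suc j) (take p ys))"
        using p by (intro sorted_wrt_take[of _ "take p ys"]) (auto simp: dec_avoiders_def)
      ultimately show ?thesis using p False by (auto simp: xs h_def dec_avoiders_def)
    qed
  next
    fix xs assume xs: "xs \<in> dec_avoiders (Suc j) (insert M S)"
    then have "M \<in> set xs" by (auto simp: dec_avoiders_def avoiders_def permutations_of_set_def)
    then obtain P Q where PQ: "xs = P @ M # Q" by (auto simp: in_set_conv_decomp)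
    have av: "P @ Q \<in> avoiders S" and P: "sorted_wrt (>) P"
      using xs avoiders_insert_max[OF assms, of P Q] by (auto simp: PQ dec_avoiders_def)
    have len: "length P + length Q = card S" using length_avoiders[OF av] by simp
    show "xs \<in> h ` (SIGMA p:{j..card S}. dec_avoiders p S)"
    proof (cases "P = []")
      case True
      have "Q \<in> dec_avoiders j S" using av xs True by (auto simp: PQ dec_avoiders_def)
      moreover have "j \<le> card S" using xs len True by (auto simp: dec_avoiders_def PQ)
      ultimately show ?thesis using True by (intro image_eqI[of _ _ "(j, Q)"]) (auto simp: h_def PQ)
    next
      case False
      \<comment> \<open>Otherwise \<open>M\<close> lies in the decreasing prefix behind a nonempty
        \<open>P\<close>, although it exceeds all letters of \<open>P\<close>.\<close>
      have *: "Suc j \<le> length P"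
      proof (rule ccontr)
        assume "\<not> Suc j \<le> length P"
        then obtain k where k: "Suc j = Suc (length P + k)" by (metis add_Suc_right less_iff_Suc_add not_le)
        have "sorted_wrt (>) (take (Suc j) xs)" using xs by (simp add: dec_avoiders_def)
        then have "sorted_wrt (>) (P @ M # take k Q)" unfolding PQ k by simp
        then have "\<forall>x\<in>set P. x > M" by (simp add: sorted_wrt_append)
        moreover have "\<forall>x\<in>set P. x < M" using av assms(2)
          by (auto simp: avoiders_def permutations_of_set_def)
        ultimately show False using False by (cases P) auto
      qed
      have "P @ Q \<in> dec_avoiders (length P) S" using av P by (auto simp: dec_avoiders_def)
      then show ?thesis using * len
        by (intro image_eqI[of _ _ "(length P, P @ Q)"]) (auto simp: h_def PQ)
    qed
  qed
  ultimately have "card (dec_avoiders (Suc j) (insert M S)) = card (SIGMA p:{j..card S}. dec_avoiders p S)"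
    by (metis card_image)
  then show ?thesis by simp
qed

lemma dec_avoiders_0: "dec_avoiders 0 S = avoiders S"
  by (auto simp: dec_avoiders_def)

text \<open>A one-letter prefix decreases trivially; this brings the case \<open>j = 0\<close> under
  the recursion for \<open>Suc j\<close>.\<close>

lemma dec_avoiders_Suc_0:
  assumes "finite S" "S \<noteq> {}"
  shows "dec_avoiders (Suc 0) S = avoiders S"
proof -
  have "Suc 0 \<le> length xs \<and> sorted_wrt (>) (take (Suc 0) xs)" if "xs \<in> avoiders S" for xs
    using that assms by (cases xs) (auto simp: avoiders_def permutations_of_set_def)
  then show ?thesis by (auto simp: dec_avoiders_def)
qed

section \<open>Powers of the Catalan series and the number of avoiders\<close>

text \<open>Squaring 1 - 2xC = sqrt(1 - 4x) and cancelling 4x gives the quadratic equation.\<close>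

lemma catalan_fps_eq: "catalan_fps = 1 + fps_X * catalan_fps ^ 2"
proof -
  define R where "R = fps_radical root 2 (1 - 4 * fps_X :: real fps)"
  have R0: "fps_nth R 0 = 1" by (simp add: R_def)
  have R2: "R ^ 2 = 1 - 4 * fps_X"
    using power_radical[of "1 - 4 * fps_X :: real fps" root 1] by (simp add: R_def numeral_2_eq_2)
  \<comment> \<open>The quotient in the closed form can be multiplied out only when the division is
    exact; the constant term 1 of \<open>R\<close> ensures this.\<close>
  have "2 * fps_X dvd 1 - R"
  proof
    show "1 - R = 2 * fps_X * (fps_const (1/2) * fps_shift 1 (1 - R))"
      using R0 by (intro fps_ext) (auto simp: mult.assoc fps_numeral_fps_const)
  qed
  then have "2 * fps_X * catalan_fps = 1 - R"
    unfolding catalan_fps_closed_form R_def[symmetric] by simp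
  then have "(1 - 2 * fps_X * catalan_fps) ^ 2 = 1 - 4 * fps_X"
    using R2 by simp
  then have "(4 * fps_X) * (1 + fps_X * catalan_fps ^ 2) = (4 * fps_X) * catalan_fps"
    by (simp add: power2_eq_square algebra_simps)
  then show ?thesis by (simp only: mult_cancel_left) auto
qed

lemma catalan_power_Suc: "catalan_fps ^ Suc k = catalan_fps ^ k + fps_X * catalan_fps ^ (k + 2)"
proof -
  have "catalan_fps ^ Suc k = catalan_fps ^ k * (1 + fps_X * catalan_fps ^ 2)"
    using catalan_fps_eq by (metis power_Suc2)
  also have "\<dots> = catalan_fps ^ k + fps_X * catalan_fps ^ (k + 2)"
    by (simp only: power_add algebra_simps mult_1_left)
  finally show ?thesis .
qed

lemma catalan_nth_0: "fps_nth (catalan_fps ^ k) 0 = 1"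
  by (induction k) (auto simp: catalan_fps_def)

text \<open>The Pascal-type recursion of the ballot numbers, which drives both the summation below
  and the binomial formula at the end.\<close>

lemma catalan_power_Suc_nth:
  "fps_nth (catalan_fps ^ Suc k) (Suc n) = fps_nth (catalan_fps ^ k) (Suc n) + fps_nth (catalan_fps ^ (k + 2)) n"
  unfolding catalan_power_Suc by (simp del: power_Suc)

text \<open>Splitting off \<open>p = j\<close> leaves the same sum for \<open>Suc j\<close> and a
  smaller \<open>m\<close>; the ballot recursion merges the two. The sum is the one produced by
  inserting the maximum.\<close>

lemma catalan_hockey_stick:
  "(\<Sum>p=j..j+m. fps_nth (catalan_fps ^ Suc p) (j + m - p)) = fps_nth (catalan_fps ^ (j + 2)) m"
proof (induction m arbitrary: j)
  case 0
  show ?case by (simp add: catalan_nth_0 del: power_Suc)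
next
  case (Suc m)
  have "(\<Sum>p=j..j + Suc m. fps_nth (catalan_fps ^ Suc p) (j + Suc m - p))
      = fps_nth (catalan_fps ^ Suc j) (Suc m) + (\<Sum>p=Suc j..Suc j + m. fps_nth (catalan_fps ^ Suc p) (Suc j + m - p))"
    by (subst sum.atLeast_Suc_atMost) (auto simp del: power_Suc)
  also have "\<dots> = fps_nth (catalan_fps ^ Suc (Suc j)) (Suc m)"
    unfolding Suc catalan_power_Suc_nth[of "Suc j"] by (simp del: power_Suc)
  finally show ?case by (simp del: power_Suc)
qed

lemma card_dec_avoiders:
  assumes "finite S" "j \<le> card S"
  shows "real (card (dec_avoiders j S)) = fps_nth (catalan_fps ^ Suc j) (card S - j)"
  using assms
proof (induction S arbitrary: j rule: finite_linorder_max_induct)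
  case empty
  have "avoiders {} = {[]}" by (auto simp: avoiders_def)
  with empty show ?case by (simp add: dec_avoiders_0 catalan_fps_def)
next
  case (insert M S)
  have M: "M \<notin> S" using insert by auto
  have *: "real (card (dec_avoiders (Suc j) (insert M S))) = fps_nth (catalan_fps ^ (j + 2)) (card S - j)"
    if "j \<le> card S" for j
  proof -
    have "real (card (dec_avoiders (Suc j) (insert M S)))
      = (\<Sum>p=j..card S. fps_nth (catalan_fps ^ Suc p) (card S - p))"
      by (subst card_dec_avoiders_insert_max) (use insert in auto)
    also have "\<dots> = fps_nth (catalan_fps ^ (j + 2)) (card S - j)"
      using catalan_hockey_stick[of j "card S - j"] that by (simp del: power_Suc)
    finally show ?thesis .
  qed
  show ?case
  proof (cases j)
    case 0
    \<comment> \<open>Prefix lengths 0 and 1 agree on a nonempty alphabet. The coefficients agree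
      too, as C^0 = 1 contributes nothing at a positive index.\<close>
    have "dec_avoiders 0 (insert M S) = dec_avoiders (Suc 0) (insert M S)"
      using dec_avoiders_Suc_0[of "insert M S"] insert by (simp add: dec_avoiders_0)
    then show ?thesis
      using *[of 0] catalan_power_Suc_nth[of 0 "card S"] insert M 0 by (simp del: power_Suc add: power_one_right) 
  next
    case (Suc i)
    then show ?thesis using *[of i] insert M by (simp del: power_Suc)
  qed
qed

lemma card_avoiders: "finite S \<Longrightarrow> real (card (avoiders S)) = fps_nth catalan_fps (card S)"
  using card_dec_avoiders[of S 0] by (simp add: dec_avoiders_0)

section \<open>Counting the two kinds of halves\<close>

text \<open>The words \<open>P b Q c\<close>, with \<open>b\<close> recovered as
  \<open>Min S\<close>; it is followed by at least two letters.\<close>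

definition left_halves :: "nat set \<Rightarrow> nat list set" where
  "left_halves S = {xs \<in> avoiders S. \<exists>P Q c. xs = P @ Min S # Q @ [c] \<and> Q \<noteq> []}"

text \<open>The words \<open>a R b T\<close> with \<open>b\<close> as \<open>Max S\<close>: the
  reverse-complement picture of the left halves.\<close>

definition right_halves :: "nat set \<Rightarrow> nat list set" where
  "right_halves S = {xs \<in> avoiders S. \<exists>a P Q. xs = a # P @ Max S # Q \<and> P \<noteq> []}"

lemma subseq3_delete:
  "subseq [x, y, z] (A @ B) \<Longrightarrow> subseq [x, y, z] (A @ m # B)"
  "subseq [x, y, z] (A @ m # B) \<Longrightarrow> m \<noteq> x \<Longrightarrow> m \<noteq> y \<Longrightarrow> m \<noteq> z \<Longrightarrow> subseq [x, y, z] (A @ B)"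
  by (auto simp: subseq_simps)

text \<open>A minimum can only start an occurrence, which needs two letters behind it.\<close>

lemma avoiders_insert_min_near_end:
  assumes "\<forall>x\<in>S. m < x" "length Q \<le> 1"
  shows "P @ m # Q \<in> avoiders (insert m S) \<longleftrightarrow> P @ Q \<in> avoiders S"
proof (cases "P @ Q \<in> permutations_of_set S")
  case True
  then have d: "set (P @ Q) = S" by (simp add: permutations_of_set_def)
  have "m \<notin> S" using assms by blast
  moreover have "subseq [x, y, z] (P @ m # Q) \<longleftrightarrow> subseq [x, y, z] (P @ Q)" if "x < y" "y < z" for x y z
  proof
    assume s: "subseq [x, y, z] (P @ m # Q)"
    have set: "{x, y, z} \<subseteq> insert m S" using subseq3_setD[OF s] d by auto
    have "m \<noteq> y" "m \<noteq> z" using set that assms(1) by force+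
    moreover have "m \<noteq> x"
    proof
      assume x: "m = x"
      have "m \<notin> set P" "m \<notin> set Q" using \<open>m \<notin> S\<close> d by auto
      then have "subseq [y, z] Q"
        using s x subseq3_setD[of m y z P] subseq2_setD[of m y P] subseq3_setD[of m y z Q]
        by (auto simp: subseq3_append subseq3_Cons)
      then show False using assms(2) list_emb_length[of "(=)" "[y, z]" Q] by simp
    qed
    ultimately show "subseq [x, y, z] (P @ Q)" using subseq3_delete(2)[OF s] by simp
  qed (simp add: subseq3_delete(1))
  ultimately show ?thesis
    using True insert_in_permutations_of_set[of m S P Q] by (auto simp: avoiders_def)
next
  case False
  have "m \<notin> S" using assms by blast
  with False show ?thesis using insert_in_permutations_of_set[of m S P Q] by (simp add: avoiders_def)
qed

lemma avoiders_insert_max_near_start: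
  assumes "\<forall>x\<in>S. x < M" "length P \<le> 1"
  shows "P @ M # Q \<in> avoiders (insert M S) \<longleftrightarrow> P @ Q \<in> avoiders S"
proof (cases "finite S")
  case True
  have "sorted_wrt (>) P" using assms(2) by (cases P) auto
  then show ?thesis using avoiders_insert_max[OF True assms(1)] by simp
next
  case False
  \<comment> \<open>An infinite set has no arrangements, so both sides are false.\<close>
  then show ?thesis by (simp add: avoiders_def permutations_of_set_infinite)
qed

text \<open>An avoider outside the left halves has \<open>m\<close> in the last or the second to
  last place. Either place is harmless, so \<open>f\<close> and \<open>g\<close> each contribute a
  disjoint copy of \<open>avoiders S\<close>.\<close>

lemma card_left_halves_insert:
  assumes "finite S" "S \<noteq> {}" "\<forall>x\<in>S. m < x"
  shows "card (left_halves (insert m S)) + 2 * card (avoiders S) = card (avoiders (insert m S))"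
proof -
  define f where "f = (\<lambda>W. W @ [m])"
  define g where "g = (\<lambda>W. butlast W @ [m, last W])"
  have Min: "Min (insert m S) = m" using assms by (intro Min_eqI) (auto intro: less_imp_le)
  have ne: "W \<noteq> []" and nm: "m \<notin> set W" if "W \<in> avoiders S" for W
    using that assms by (auto simp: avoiders_def permutations_of_set_def)
  have g_ex: "\<exists>P c. W = P @ [c] \<and> g W = P @ [m, c]" if "W \<in> avoiders S" for W
    using ne[OF that] by (intro exI[of _ "butlast W"] exI[of _ "last W"]) (simp add: g_def)
  have "inj_on f (avoiders S)" by (auto simp: inj_on_def f_def)
  moreover have "inj_on g (avoiders S)"
  proof (rule inj_onI)
    fix V W assume V: "V \<in> avoiders S" and W: "W \<in> avoiders S" and eq: "g V = g W"
    obtain P c P' c' where "V = P @ [c]" "g V = P @ [m, c]" "W = P' @ [c']" "g W = P' @ [m, c']"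
      using g_ex[OF V] g_ex[OF W] by blast
    then show "V = W" using eq by simp
  qed
  moreover have "avoiders (insert m S) = left_halves (insert m S) \<union> (f ` avoiders S \<union> g ` avoiders S)"
  proof (intro equalityI subsetI)
    fix xs assume xs: "xs \<in> avoiders (insert m S)"
    then have "m \<in> set xs" by (auto simp: avoiders_def permutations_of_set_def)
    then obtain P Q where PQ: "xs = P @ m # Q" by (auto simp: in_set_conv_decomp)
    show "xs \<in> left_halves (insert m S) \<union> (f ` avoiders S \<union> g ` avoiders S)"
    proof (cases Q rule: rev_cases)
      case Nil
      then have "P \<in> avoiders S" "xs = f P"
        using avoiders_insert_min_near_end[OF assms(3), of "[]" P] xs PQ by (auto simp: f_def)
      then show ?thesis by blast
    next
      case (snoc R c)
      show ?thesis
      proof (cases "R = []")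
        case True
        then have "P @ [c] \<in> avoiders S" "xs = g (P @ [c])"
          using avoiders_insert_min_near_end[OF assms(3), of "[c]" P] xs PQ snoc by (auto simp: g_def)
        then show ?thesis by blast
      next
        case False
        then show ?thesis using xs PQ snoc by (auto simp: left_halves_def Min)
      qed
    qed
  next
    fix xs assume "xs \<in> left_halves (insert m S) \<union> (f ` avoiders S \<union> g ` avoiders S)"
    moreover have "f W \<in> avoiders (insert m S)" if "W \<in> avoiders S" for W
      using that avoiders_insert_min_near_end[OF assms(3), of "[]" W] by (simp add: f_def)
    moreover have "g W \<in> avoiders (insert m S)" if W: "W \<in> avoiders S" for W
    proof -
      obtain P c where "W = P @ [c]" "g W = P @ [m, c]" using g_ex[OF W] by blast
      then show ?thesis using W avoiders_insert_min_near_end[OF assms(3), of "[c]" P] by simp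
    qed
    ultimately show "xs \<in> avoiders (insert m S)" by (auto simp: left_halves_def)
  qed
  moreover have "f ` avoiders S \<inter> g ` avoiders S = {}"
  proof -
    have "f V \<noteq> g W" if "W \<in> avoiders S" for V W
      using nm[OF that] g_ex[OF that] by (auto simp: f_def)
    then show ?thesis by blast
  qed
  moreover have "left_halves (insert m S) \<inter> (f ` avoiders S \<union> g ` avoiders S) = {}"
  proof -
    have "f W \<notin> left_halves (insert m S)" "g W \<notin> left_halves (insert m S)"
      if W: "W \<in> avoiders S" for W
    proof -
      show "f W \<notin> left_halves (insert m S)"
        using nm[OF W] by (auto simp: left_halves_def Min f_def append_Cons_eq_iff)
      obtain P c where "W = P @ [c]" "g W = P @ [m, c]" using g_ex[OF W] by blast
      then show "g W \<notin> left_halves (insert m S)"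
        using nm[OF W] by (auto simp: left_halves_def Min append_Cons_eq_iff)
    qed
    then show ?thesis by blast
  qed
  moreover have "finite (left_halves (insert m S))"
    by (rule finite_subset[OF _ finite_avoiders[of "insert m S"]]) (auto simp: left_halves_def)
  ultimately show ?thesis
    by (simp add: card_Un_disjoint card_image)
qed

text \<open>The same count, with the maximum in the first or second place as the excluded
  positions.\<close>

lemma card_right_halves_insert:
  assumes "finite S" "S \<noteq> {}" "\<forall>x\<in>S. x < M"
  shows "card (right_halves (insert M S)) + 2 * card (avoiders S) = card (avoiders (insert M S))"
proof -
  define f where "f = (\<lambda>W. M # W)"
  define g where "g = (\<lambda>W. hd W # M # tl W)"
  have Max: "Max (insert M S) = M" using assms by (intro Max_eqI) (auto intro: less_imp_le)
  have ne: "W \<noteq> []" and nm: "M \<notin> set W" if "W \<in> avoiders S" for W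
    using that assms by (auto simp: avoiders_def permutations_of_set_def)
  have g_ex: "\<exists>a P. W = a # P \<and> g W = a # M # P" if "W \<in> avoiders S" for W
    using ne[OF that] by (cases W) (auto simp: g_def)
  have "inj_on f (avoiders S)" by (auto simp: inj_on_def f_def)
  moreover have "inj_on g (avoiders S)"
    by (rule inj_onI) (metis g_ex list.inject)
  moreover have "avoiders (insert M S) = right_halves (insert M S) \<union> (f ` avoiders S \<union> g ` avoiders S)"
  proof (intro equalityI subsetI)
    fix xs assume xs: "xs \<in> avoiders (insert M S)"
    then have "M \<in> set xs" by (auto simp: avoiders_def permutations_of_set_def)
    then obtain P Q where PQ: "xs = P @ M # Q" by (auto simp: in_set_conv_decomp)
    show "xs \<in> right_halves (insert M S) \<union> (f ` avoiders S \<union> g ` avoiders S)"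
    proof (cases P)
      case Nil
      then have "Q \<in> avoiders S" "xs = f Q"
        using avoiders_insert_max_near_start[OF assms(3), of "[]" Q] xs PQ by (auto simp: f_def)
      then show ?thesis by blast
    next
      case (Cons a R)
      show ?thesis
      proof (cases "R = []")
        case True
        then have "a # Q \<in> avoiders S" "xs = g (a # Q)"
          using avoiders_insert_max_near_start[OF assms(3), of "[a]" Q] xs PQ Cons by (auto simp: g_def)
        then show ?thesis by blast
      next
        case False
        then show ?thesis using xs PQ Cons by (auto simp: right_halves_def Max)
      qed
    qed
  next
    fix xs assume "xs \<in> right_halves (insert M S) \<union> (f ` avoiders S \<union> g ` avoiders S)"
    moreover have "f W \<in> avoiders (insert M S)" if "W \<in> avoiders S" for W
      using that avoiders_insert_max_near_start[OF assms(3), of "[]" W] by (simp add: f_def)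
    moreover have "g W \<in> avoiders (insert M S)" if W: "W \<in> avoiders S" for W
    proof -
      obtain a P where "W = a # P" "g W = a # M # P" using g_ex[OF W] by blast
      then show ?thesis using W avoiders_insert_max_near_start[OF assms(3), of "[a]" P] by simp
    qed
    ultimately show "xs \<in> avoiders (insert M S)" by (auto simp: right_halves_def)
  qed
  moreover have "f ` avoiders S \<inter> g ` avoiders S = {}"
  proof -
    have "f V \<noteq> g W" if "W \<in> avoiders S" for V W
      using nm[OF that] g_ex[OF that] by (auto simp: f_def)
    then show ?thesis by blast
  qed
  moreover have "right_halves (insert M S) \<inter> (f ` avoiders S \<union> g ` avoiders S) = {}"
  proof -
    have "f W \<notin> right_halves (insert M S)" "g W \<notin> right_halves (insert M S)"
      if W: "W \<in> avoiders S" for W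
    proof -
      show "f W \<notin> right_halves (insert M S)"
        using nm[OF W] by (auto simp: right_halves_def Max f_def)
      obtain a P where "W = a # P" "g W = a # M # P" using g_ex[OF W] by blast
      then show "g W \<notin> right_halves (insert M S)"
        using nm[OF W] by (auto simp: right_halves_def Max Cons_eq_append_conv)
    qed
    then show ?thesis by blast
  qed
  moreover have "finite (right_halves (insert M S))"
    by (rule finite_subset[OF _ finite_avoiders[of "insert M S"]]) (auto simp: right_halves_def)
  ultimately show ?thesis
    by (simp add: card_Un_disjoint card_image)
qed

text \<open>Applying the quadratic equation three times gives x^3 C^4 = C - 1 - 2xC + x; the
  polynomial part -1 + x cancels the coefficients at 0 and 1.\<close>

lemma half_fps_nth:
  "fps_nth (fps_X ^ 3 * catalan_fps ^ 4) n =
     (if n \<ge> 2 then fps_nth catalan_fps n - 2 * fps_nth catalan_fps (n - 1) else 0)"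
proof -
  have 1: "fps_X * catalan_fps ^ 2 = catalan_fps - 1" using catalan_fps_eq by (simp add: algebra_simps)
  have 2: "fps_X * catalan_fps ^ 3 = catalan_fps ^ 2 - catalan_fps"
    using catalan_power_Suc[of 1] by (simp del: power_Suc add: numeral_3_eq_3 numeral_2_eq_2)
  have 3: "fps_X * catalan_fps ^ 4 = catalan_fps ^ 3 - catalan_fps ^ 2"
    using catalan_power_Suc[of 2] by (simp del: power_Suc add: numeral_eq_Suc)
  have "fps_X ^ 3 * catalan_fps ^ 4 = fps_X * (fps_X * (fps_X * catalan_fps ^ 4))"
    by (simp add: power3_eq_cube mult.assoc)
  also have "\<dots> = catalan_fps - 1 - fps_X * catalan_fps - fps_X * catalan_fps + fps_X"
    unfolding 3 by (simp only: right_diff_distrib 1 2) (simp add: algebra_simps)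
  finally have eq: "fps_X ^ 3 * catalan_fps ^ 4 =
    catalan_fps - 1 - fps_X * catalan_fps - fps_X * catalan_fps + fps_X" .
  have "fps_nth catalan_fps 0 = 1" "fps_nth catalan_fps (Suc 0) = 1" by (simp_all add: catalan_fps_def)
  then show ?thesis
    unfolding eq fps_sub_nth fps_add_nth fps_X_mult_nth by (cases "n = 0"; cases "n = 1") auto
qed

lemma card_left_halves:
  assumes "finite S" "S \<noteq> {}"
  shows "real (card (left_halves S)) = fps_nth (fps_X ^ 3 * catalan_fps ^ 4) (card S)"
proof -
  define T where "T = S - {Min S}"
  have S: "S = insert (Min S) T" "Min S \<notin> T" using Min_in[OF assms] by (auto simp: T_def)
  have T: "finite T" "\<forall>x\<in>T. Min S < x" using assms by (auto simp: T_def less_le)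
  have card: "card S = Suc (card T)" using S T by (metis card_insert_disjoint)
  show ?thesis
  proof (cases "T = {}")
    case True
    \<comment> \<open>A half has at least three letters, so a singleton alphabet admits none,
      matching the zero coefficient at 1.\<close>
    then have "left_halves S = {}"
      using length_avoiders[of _ S] card by (fastforce simp: left_halves_def)
    then show ?thesis using True card by (simp add: half_fps_nth)
  next
    case False
    have "real (card (left_halves S)) + 2 * real (card (avoiders T)) = real (card (avoiders S))"
      using card_left_halves_insert[OF T(1) False T(2)] S(1) by (metis of_nat_add of_nat_mult of_nat_numeral)
    moreover have "card T \<ge> 1" using False T by (simp add: Suc_le_eq card_gt_0_iff)
    ultimately show ?thesis using card_avoiders T assms card by (simp add: half_fps_nth)
  qed
qed

lemma card_right_halves:
  assumes "finite S" "S \<noteq> {}"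
  shows "real (card (right_halves S)) = fps_nth (fps_X ^ 3 * catalan_fps ^ 4) (card S)"
proof -
  define T where "T = S - {Max S}"
  have S: "S = insert (Max S) T" "Max S \<notin> T" using Max_in[OF assms] by (auto simp: T_def)
  have T: "finite T" "\<forall>x\<in>T. x < Max S" using assms by (auto simp: T_def less_le)
  have card: "card S = Suc (card T)" using S T by (metis card_insert_disjoint)
  show ?thesis
  proof (cases "T = {}")
    case True
    then have "right_halves S = {}"
      using length_avoiders[of _ S] card by (fastforce simp: right_halves_def)
    then show ?thesis using True card by (simp add: half_fps_nth)
  next
    case False
    have "real (card (right_halves S)) + 2 * real (card (avoiders T)) = real (card (avoiders S))"
      using card_right_halves_insert[OF T(1) False T(2)] S(1) by (metis of_nat_add of_nat_mult of_nat_numeral)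
    moreover have "card T \<ge> 1" using False T by (simp add: Suc_le_eq card_gt_0_iff)
    ultimately show ?thesis using card_avoiders T assms card by (simp add: half_fps_nth)
  qed
qed

section \<open>Splitting a word at its only occurrence of 1-2-3\<close>

text \<open>A smaller \<open>v\<close> left of \<open>b\<close> would give a second occurrence
  \<open>v b c\<close>, a larger one on the right \<open>a b v\<close>; this fixes both alphabets.
  In the left word \<open>b\<close> takes the place of \<open>a\<close>, in the right word that of
  \<open>c\<close>, and occurrences are carried across by exchanging these letters.\<close>

lemma unique_occurrence_iff:
  "P @ a # Q @ b # R @ c # T \<in> permutations_of_set {1..n} \<and> a < b \<and> b < c \<and>
    (\<forall>x y z. x < y \<and> y < z \<and> subseq [x, y, z] (P @ a # Q @ b # R @ c # T) \<longrightarrow> x = a \<and> y = b \<and> z = c)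
   \<longleftrightarrow> P @ b # Q @ [c] \<in> avoiders {b..n} \<and> a # R @ b # T \<in> avoiders {1..b}"
  (is "?xs \<in> _ \<and> _ \<and> _ \<and> ?uniq \<longleftrightarrow> _")
proof (intro iffI conjI; (elim conjE)?)
  assume perm: "?xs \<in> permutations_of_set {1..n}" and ab: "a < b" and bc: "b < c" and uniq: ?uniq
  have d: "distinct ?xs" and set: "set ?xs = {1..n}" using perm by (auto simp: permutations_of_set_def)
  have l: "b < v" if "v \<in> set P \<union> set Q" for v
  proof (rule ccontr)
    assume "\<not> b < v"
    then have "v < b" using d that by (auto simp: not_less le_less)
    moreover have "subseq [v, b, c] ?xs" using that by (auto simp: subseq_simps)
    ultimately have "v = a" using uniq bc by blast
    then show False using d that by auto
  qed
  have r: "v < b" if "v \<in> set R \<union> set T" for v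
  proof (rule ccontr)
    assume "\<not> v < b"
    then have "b < v" using d that by (auto simp: not_less le_less)
    moreover have "subseq [a, b, v] ?xs" using that by (auto simp: subseq_simps)
    ultimately have "v = c" using uniq ab by blast
    then show False using d that by auto
  qed
  have sets: "v \<in> {1..n} \<longleftrightarrow> v \<in> set P \<or> v = a \<or> v \<in> set Q \<or> v = b \<or> v \<in> set R \<or> v = c \<or> v \<in> set T" for v
    unfolding set[symmetric] by auto
  have "set (P @ b # Q @ [c]) = {b..n}"
  proof (intro set_eqI iffI)
    fix v assume "v \<in> set (P @ b # Q @ [c])"
    then show "v \<in> {b..n}" using l[of v] bc sets[of v] by auto
  next
    fix v assume "v \<in> {b..n}"
    then show "v \<in> set (P @ b # Q @ [c])" using r[of v] ab sets[of v] sets[of b] by auto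
  qed
  moreover have "\<not> subseq [x, y, z] (P @ b # Q @ [c])" if "x < y" "y < z" for x y z
  proof
    assume s: "subseq [x, y, z] (P @ b # Q @ [c])"
    have ge: "b \<le> x" using subseq3_setD[OF s] l[of x] bc by auto
    show False
    proof (cases "x = b")
      case True
      \<comment> \<open>Here \<open>b\<close> starts the occurrence. Putting back the smaller
        \<open>a\<close> in its place gives an occurrence in the full word whose middle letter is
        not \<open>b\<close>.\<close>
      have "b \<notin> set P" "b \<notin> set Q" using d by auto
      then have yz: "subseq [y, z] (Q @ [c])"
        using s True by (auto simp: subseq_simps dest: subseq2_setD subseq3_setD)
      then have "subseq [a, y, z] ?xs" by (auto simp: subseq_simps)
      then have "y = b" using uniq True that ab by (meson less_trans)
      then show False using True that by simp
    next
      case False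
      then have "subseq [x, y, z] (P @ Q @ [c])"
        using subseq3_delete(2)[OF s] ge that by simp
      then have s: "subseq [x, y, z] ?xs" and x: "x \<in> set (P @ Q @ [c])"
        by (auto simp: subseq_simps dest: subseq3_setD subseq2_setD)
      then have "x = a" using uniq that by blast
      then show False using x d bc ab by auto
    qed
  qed
  ultimately show "P @ b # Q @ [c] \<in> avoiders {b..n}"
    using d bc by (auto simp: avoiders_def permutations_of_set_def)
  have "set (a # R @ b # T) = {1..b}"
  proof (intro set_eqI iffI)
    fix v assume "v \<in> set (a # R @ b # T)"
    then show "v \<in> {1..b}" using r[of v] ab sets[of v] by auto
  next
    fix v assume "v \<in> {1..b}"
    then show "v \<in> set (a # R @ b # T)" using l[of v] bc sets[of v] sets[of b] by auto
  qed
  moreover have "\<not> subseq [x, y, z] (a # R @ b # T)" if "x < y" "y < z" for x y z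
  proof
    assume s: "subseq [x, y, z] (a # R @ b # T)"
    have le: "z \<le> b" using subseq3_setD[OF s] r[of z] ab by auto
    show False
    proof (cases "z = b")
      case True
      \<comment> \<open>Dually, \<open>b\<close> ends the occurrence and the larger \<open>c\<close>
        is put back in its place.\<close>
      have "b \<notin> set T" "b \<notin> set R" "a \<noteq> b" using d by auto
      then have xy: "subseq [x, y] (a # R)"
        using s True by (auto simp: subseq_simps dest: subseq2_setD subseq3_setD)
      then have "subseq [x, y, c] ?xs" by (auto simp: subseq_simps)
      then have "y = b" using uniq True that bc by (meson less_trans)
      then show False using True that by simp
    next
      case False
      then have "subseq [x, y, z] ((a # R) @ T)"
        using subseq3_delete(2)[of x y z "a # R" b T] s le that by simp
      then have "subseq [x, y, z] ?xs"
        by (auto simp: subseq_simps)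
      then have "y = b" using uniq that by blast
      then show False using False le that by auto
    qed
  qed
  ultimately show "a # R @ b # T \<in> avoiders {1..b}"
    using d ab by (auto simp: avoiders_def permutations_of_set_def)
next
  assume U: "P @ b # Q @ [c] \<in> avoiders {b..n}" and V: "a # R @ b # T \<in> avoiders {1..b}"
  then have dU: "distinct (P @ b # Q @ [c])" and dV: "distinct (a # R @ b # T)"
    and sU: "set (P @ b # Q @ [c]) = {b..n}" and sV: "set (a # R @ b # T) = {1..b}"
    by (auto simp: avoiders_def permutations_of_set_def)
  have b: "1 \<le> b" "b \<le> n" using sU sV by auto
  have "v \<in> {b..n}" if "v \<in> set P \<union> set Q \<union> {c}" for v using that unfolding sU[symmetric] by auto
  then have l: "b < v" if "v \<in> set P \<union> set Q \<union> {c}" for v using that dU by (force simp: le_less)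
  have "v \<in> {1..b}" if "v \<in> set R \<union> set T \<union> {a}" for v using that unfolding sV[symmetric] by auto
  then have r: "v < b" if "v \<in> set R \<union> set T \<union> {a}" for v using that dV by (force simp: le_less)
  have disj: "(set P \<union> set Q \<union> {c}) \<inter> (set R \<union> set T \<union> {a}) = {}"
    using l r by (blast dest: less_asym)
  show ab: "a < b" and bc: "b < c" using l r by auto
  have "{1..n} = {b..n} \<union> {1..b}" using b by auto
  then have "set ?xs = {1..n}" unfolding sU[symmetric] sV[symmetric] by auto
  moreover have d: "distinct ?xs" using dU dV disj by auto
  ultimately show "?xs \<in> permutations_of_set {1..n}" by (simp add: permutations_of_set_def)
  have nU: False if "subseq [x, y, z] (P @ b # Q @ [c])" "x < y" "y < z" for x y z
    using U that by (auto simp: avoiders_def)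
  have nV: False if "subseq [x, y, z] (a # R @ b # T)" "x < y" "y < z" for x y z
    using V that by (auto simp: avoiders_def)
  show ?uniq
  proof (intro allI impI, elim conjE)
    fix x y z assume xy: "x < y" and yz: "y < z" and s: "subseq [x, y, z] ?xs"
    have notin: "a \<notin> set P \<union> set Q \<union> set R \<union> set T" "c \<notin> set P \<union> set Q \<union> set R \<union> set T" using d by auto
    have left: "b < v" if "v \<in> set (P @ a # Q)" "v \<noteq> a" for v using that l by auto
    have right: "v < b" if "v \<in> set (R @ c # T)" "v \<noteq> c" for v using that r by auto
    have a_le: "a \<le> v" if "v \<in> set (P @ a # Q)" for v using left[of v] that ab by (cases "v = a") auto
    have le_c: "v \<le> c" if "v \<in> set (R @ c # T)" for v using right[of v] that bc by (cases "v = c") auto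
    \<comment> \<open>Cases by how many letters lie left of \<open>b\<close> and whether
      \<open>b\<close> itself is used. Only the third survives: left of \<open>b\<close> just
      \<open>a\<close> is smaller than \<open>b\<close>, and right of it just \<open>c\<close> is
      larger.\<close>
    consider "subseq [x, y, z] (P @ a # Q)" | "subseq [x, y] (P @ a # Q)" "z \<in> set (b # R @ c # T)"
      | "x \<in> set (P @ a # Q)" "y = b" "z \<in> set (R @ c # T)"
      | "x \<in> set (P @ a # Q)" "subseq [y, z] (R @ c # T)"
      | "x = b" "subseq [y, z] (R @ c # T)"
      | "subseq [x, y, z] (R @ c # T)"
      using s subseq3_append[of x y z "P @ a # Q" "b # R @ c # T"] by (auto simp: subseq3_Cons subseq2_Cons)
    then show "x = a \<and> y = b \<and> z = c"
    proof cases
      case 1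
      have "y \<noteq> a" "z \<noteq> a" using a_le[of x] subseq3_setD[OF 1] xy yz by auto
      show ?thesis
      proof (cases "x = a")
        case True
        then have "subseq [y, z] Q" using 1 notin subseq3_setD[of a y z P] subseq2_setD[of a y P] subseq3_setD[of a y z Q]
          by (auto simp: subseq3_append subseq3_Cons)
        then have "subseq [b, y, z] (P @ b # Q @ [c])" by (auto simp: subseq_simps)
        moreover have "b < y" using subseq2_setD[OF \<open>subseq [y, z] Q\<close>] l[of y] by simp
        ultimately show ?thesis using nU[of b y z] yz by simp
      next
        case False
        then have "subseq [x, y, z] (P @ Q)" using subseq3_delete(2)[OF 1] \<open>y \<noteq> a\<close> \<open>z \<noteq> a\<close> by simp
        then have "subseq [x, y, z] (P @ b # Q @ [c])" by (auto simp: subseq_simps)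
        then show ?thesis using nU[of x y z] xy yz by simp
      qed
    next
      case 2
      have "y \<noteq> a" using subseq2_setD[OF 2(1)] a_le[of x] xy by auto
      then have "b < y" using subseq2_setD[OF 2(1)] left[of y] by simp
      then have z: "z = c" using 2(2) yz right[of z] by force
      \<comment> \<open>\<open>z = c\<close> stands last in the left word, and an initial
        \<open>a\<close> is traded for \<open>b\<close>, which is still below
        \<open>y\<close>.\<close>
      have "subseq [if x = a then b else x, y, c] (P @ b # Q @ [c])"
        using 2(1) notin \<open>y \<noteq> a\<close> subseq2_setD[of a y P] subseq2_setD[of a y Q]
        by (auto simp: subseq_simps)
      then show ?thesis using nU[of "if x = a then b else x" y c] xy yz z \<open>b < y\<close> by (auto split: if_splits)
    next
      case 3
      have "x = a" using left[of x] 3 xy by fastforce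
      moreover have "z = c" using right[of z] 3 yz by fastforce
      ultimately show ?thesis using 3 by blast
    next
      case 4
      have yz': "y \<in> set (R @ c # T)" "z \<in> set (R @ c # T)" using subseq2_setD[OF 4(2)] by auto
      have "y \<noteq> c" using le_c[of z] yz' yz by auto
      then have "y < b" using right yz' by blast
      then have "x = a" using left[of x] 4 xy by fastforce
      \<comment> \<open>\<open>a\<close> heads the right word, and a final \<open>c\<close> is
        traded for \<open>b\<close>, which is still above \<open>y\<close>.\<close>
      have "subseq [a, y, if z = c then b else z] (a # R @ b # T)"
        using 4(2) notin \<open>y \<noteq> c\<close> subseq2_setD[of y c R] subseq2_setD[of y c T]
        by (auto simp: subseq_simps)
      then show ?thesis using nV[of a y "if z = c then b else z"] xy yz \<open>x = a\<close> \<open>y < b\<close> by (auto split: if_splits)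
    next
      case 5
      have "y \<in> set (R @ c # T)" "z \<in> set (R @ c # T)" using subseq2_setD[OF 5(2)] by auto
      then have "y = c" using right[of y] 5(1) xy \<open>y \<in> _\<close> by force
      moreover have "z \<le> c" using le_c \<open>z \<in> _\<close> by blast
      ultimately show ?thesis using yz by simp
    next
      case 6
      have m: "x \<in> set (R @ c # T)" "y \<in> set (R @ c # T)" "z \<in> set (R @ c # T)" using subseq3_setD[OF 6] by auto
      have "x \<noteq> c" "y \<noteq> c" using le_c[of z] m xy yz by auto
      then have "y < b" using right m by blast
      have "subseq [x, y, if z = c then b else z] (a # R @ b # T)"
        using 6 notin \<open>x \<noteq> c\<close> \<open>y \<noteq> c\<close> subseq2_setD[of y c T] subseq3_setD[of x y c R] subseq3_setD[of x y c T]
        by (auto simp: subseq_simps)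
      then show ?thesis using nV[of x y "if z = c then b else z"] xy yz \<open>y < b\<close> by (auto split: if_splits)
    qed
  qed
qed

section \<open>From permutations as functions to decomposed words\<close>

text \<open>Nonempty \<open>Q\<close> and \<open>R\<close> encode the two adjacency conditions;
  \<open>a < b < c\<close> and the range of the letters follow from
  \<open>unique_occurrence_iff\<close>.\<close>

definition split_perms :: "nat \<Rightarrow> (nat list \<times> nat \<times> nat list \<times> nat \<times> nat list \<times> nat \<times> nat list) set" where
  "split_perms n = {(P, a, Q, b, R, c, T). Q \<noteq> [] \<and> R \<noteq> [] \<and>
     P @ b # Q @ [c] \<in> avoiders {b..n} \<and> a # R @ b # T \<in> avoiders {1..b}}"

lemma subseq2_map_upt:
  "subseq [x, y] (map f [1..<Suc n]) \<longleftrightarrow> (\<exists>i j. 1 \<le> i \<and> i < j \<and> j \<le> n \<and> x = f i \<and> y = f j)"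
proof (induction n)
  case (Suc n)
  have "subseq [x, y] (map f [1..<Suc (Suc n)]) \<longleftrightarrow>
      subseq [x, y] (map f [1..<Suc n]) \<or> (\<exists>i. 1 \<le> i \<and> i \<le> n \<and> x = f i \<and> y = f (Suc n))"
  proof -
    have "[1..<Suc (Suc n)] = [1..<Suc n] @ [Suc n]" by simp
    then show ?thesis by (auto simp: subseq2_append subseq2_Cons simp del: upt_Suc)
  qed
  also have "\<dots> \<longleftrightarrow> (\<exists>i j. 1 \<le> i \<and> i < j \<and> j \<le> Suc n \<and> x = f i \<and> y = f j)"
    unfolding Suc.IH le_Suc_eq using less_Suc_eq_le[of _ n] by blast
  finally show ?case .
qed auto

text \<open>Bridges subsequences of values and the position triples in
  \<open>occ_1_2_3\<close>.\<close>

lemma subseq3_map_upt: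
  "subseq [x, y, z] (map f [1..<Suc n]) \<longleftrightarrow>
     (\<exists>i j m. 1 \<le> i \<and> i < j \<and> j < m \<and> m \<le> n \<and> x = f i \<and> y = f j \<and> z = f m)"
proof (induction n)
  case (Suc n)
  have "subseq [x, y, z] (map f [1..<Suc (Suc n)]) \<longleftrightarrow>
      subseq [x, y, z] (map f [1..<Suc n]) \<or> subseq [x, y] (map f [1..<Suc n]) \<and> z = f (Suc n)"
  proof -
    have "[1..<Suc (Suc n)] = [1..<Suc n] @ [Suc n]" by simp
    then show ?thesis by (auto simp: subseq3_append subseq3_Cons subseq2_Cons simp del: upt_Suc)
  qed
  also have "\<dots> \<longleftrightarrow> (\<exists>i j m. 1 \<le> i \<and> i < j \<and> j < m \<and> m \<le> Suc n \<and> x = f i \<and> y = f j \<and> z = f m)"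
    unfolding Suc.IH subseq2_map_upt le_Suc_eq using less_Suc_eq_le[of _ n] by blast
  finally show ?case .
qed auto

text \<open>Surjectivity comes from counting: both sides have n! elements.\<close>

lemma bij_betw_permutes_permutations_of_set:
  "bij_betw (\<lambda>\<pi>. map \<pi> [1..<Suc n]) {\<pi>. \<pi> permutes {1..n}} (permutations_of_set {1..n})"
proof -
  let ?l = "\<lambda>\<pi>. map \<pi> [1..<Suc n] :: nat list"
  have inj: "inj_on ?l {\<pi>. \<pi> permutes {1..n}}"
  proof (rule inj_onI, rule ext)
    fix \<pi> \<rho> :: "nat \<Rightarrow> nat" and i
    assume "\<pi> \<in> {\<pi>. \<pi> permutes {1..n}}" "\<rho> \<in> {\<pi>. \<pi> permutes {1..n}}" and eq: "?l \<pi> = ?l \<rho>"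
    moreover have "\<pi> k = \<rho> k" if "1 \<le> k" "k \<le> n" for k
    proof -
      have "k \<in> set [1..<Suc n]" using that by (simp del: upt_Suc)
      then show ?thesis using eq unfolding map_eq_conv by blast
    qed
    ultimately show "\<pi> i = \<rho> i"
      by (cases "i \<in> {1..n}") (auto simp: permutes_not_in)
  qed
  moreover have sub: "?l ` {\<pi>. \<pi> permutes {1..n}} \<subseteq> permutations_of_set {1..n}"
  proof (rule image_subsetI, elim CollectE)
    fix \<pi> :: "nat \<Rightarrow> nat" assume p: "\<pi> permutes {1..n}"
    have "set [1..<Suc n] = {1..n}" by auto
    then show "?l \<pi> \<in> permutations_of_set {1..n}"
      using permutes_image[OF p] permutes_inj_on[OF p]
      by (auto simp: permutations_of_set_def distinct_map simp del: upt_Suc)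
  qed
  moreover have "card (?l ` {\<pi>. \<pi> permutes {1..n}}) = card (permutations_of_set {1..n})"
    unfolding card_image[OF inj] by (subst card_permutations[OF refl]) simp_all
  ultimately show ?thesis
    unfolding bij_betw_def by (meson card_subset_eq finite_permutations_of_set)
qed

lemma upt_split: "i \<le> k \<Longrightarrow> k < n \<Longrightarrow> [i..<n] = [i..<k] @ k # [Suc k..<n]"
  using upt_add_eq_append[of i k "n - k"] upt_conv_Cons[of k n] by simp

lemma f_num_condition_iff:
  assumes "\<pi> permutes {1..n}"
  shows "card (occ_1_2_3 n \<pi>) = 1 \<and> card (occ_1_23 n \<pi>) = 0 \<and> card (occ_12_3 n \<pi>) = 0 \<longleftrightarrow>
    (\<exists>(P, a, Q, b, R, c, T)\<in>split_perms n. map \<pi> [1..<Suc n] = P @ a # Q @ b # R @ c # T)"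
    (is "?l \<longleftrightarrow> ?r")
proof
  assume l: ?l
  then obtain i j m where occ: "occ_1_2_3 n \<pi> = {(i, j, m)}"
    by (metis card_1_singletonE prod_cases3)
  then have "(i, j, m) \<in> occ_1_2_3 n \<pi>" by simp
  then have ijm: "1 \<le> i" "i < j" "j < m" "m \<le> n" "\<pi> i < \<pi> j" "\<pi> j < \<pi> m"
    unfolding occ_1_2_3_def by auto
  \<comment> \<open>Finiteness is essential here, since \<open>card\<close> is also 0 on infinite
    sets.\<close>
  have "(i, j, m) \<notin> occ_1_23 n \<pi>" "(i, j, m) \<notin> occ_12_3 n \<pi>"
    using l finite_occ(2,3)[of n \<pi>] by auto
  then have ne: "m \<noteq> Suc j" "j \<noteq> Suc i" using occ by (auto simp: occ_1_23_def occ_12_3_def)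
  define P where "P = map \<pi> [1..<i]"
  define Q where "Q = map \<pi> [Suc i..<j]"
  define R where "R = map \<pi> [Suc j..<m]"
  define T where "T = map \<pi> [Suc m..<Suc n]"
  have "[1..<Suc n] = [1..<i] @ i # [Suc i..<j] @ j # [Suc j..<m] @ m # [Suc m..<Suc n]"
    using ijm upt_split[of 1 i "Suc n"] upt_split[of "Suc i" j "Suc n"] upt_split[of "Suc j" m "Suc n"]
    by (simp del: upt_Suc)
  then have xs: "map \<pi> [1..<Suc n] = P @ \<pi> i # Q @ \<pi> j # R @ \<pi> m # T"
    by (simp add: P_def Q_def R_def T_def del: upt_Suc)
  have "\<forall>x y z. x < y \<and> y < z \<and> subseq [x, y, z] (map \<pi> [1..<Suc n]) \<longrightarrow> x = \<pi> i \<and> y = \<pi> j \<and> z = \<pi> m"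
  proof (intro allI impI, elim conjE)
    fix x y z assume "x < y" "y < z" "subseq [x, y, z] (map \<pi> [1..<Suc n])"
    then obtain i' j' m' where o: "1 \<le> i'" "i' < j'" "j' < m'" "m' \<le> n"
      "x = \<pi> i'" "y = \<pi> j'" "z = \<pi> m'"
      unfolding subseq3_map_upt by blast
    then have "(i', j', m') \<in> occ_1_2_3 n \<pi>" using \<open>x < y\<close> \<open>y < z\<close> by (auto simp: occ_1_2_3_def)
    then show "x = \<pi> i \<and> y = \<pi> j \<and> z = \<pi> m" using occ o by auto
  qed
  moreover have "map \<pi> [1..<Suc n] \<in> permutations_of_set {1..n}"
    using bij_betw_permutes_permutations_of_set[of n] assms unfolding bij_betw_def by blast
  ultimately have "P @ \<pi> j # Q @ [\<pi> m] \<in> avoiders {\<pi> j..n} \<and> \<pi> i # R @ \<pi> j # T \<in> avoiders {1..\<pi> j}"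
    unfolding xs using ijm by (intro iffD1[OF unique_occurrence_iff]) simp
  moreover have "Q \<noteq> []" "R \<noteq> []" using ijm ne by (auto simp: Q_def R_def)
  ultimately have "(P, \<pi> i, Q, \<pi> j, R, \<pi> m, T) \<in> split_perms n"
    by (simp add: split_perms_def)
  then show ?r using xs by blast
next
  assume ?r
  then obtain P a Q b R c T where s: "(P, a, Q, b, R, c, T) \<in> split_perms n"
    and xs: "map \<pi> [1..<Suc n] = P @ a # Q @ b # R @ c # T" by blast
  have *: "a < b \<and> b < c \<and>
      (\<forall>x y z. x < y \<and> y < z \<and> subseq [x, y, z] (map \<pi> [1..<Suc n]) \<longrightarrow> x = a \<and> y = b \<and> z = c)"
    using s unique_occurrence_iff[of P a Q b R c T n] unfolding xs by (simp add: split_perms_def)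
  then have abc: "a < b" "b < c" by simp_all
  have uniq: "x = a \<and> y = b \<and> z = c" if "x < y" "y < z" "subseq [x, y, z] (map \<pi> [1..<Suc n])" for x y z
    using * that by (simp del: upt_Suc)
  have ne: "Q \<noteq> []" "R \<noteq> []" using s by (auto simp: split_perms_def)
  \<comment> \<open>Positions count from 1 but list indices from 0, hence each
    \<open>Suc\<close>.\<close>
  define i where "i = Suc (length P)"
  define j where "j = Suc (i + length Q)"
  define m where "m = Suc (j + length R)"
  have len: "n = length P + length Q + length R + length T + 3"
    using arg_cong[OF xs, of length] by (simp del: upt_Suc)
  have nth: "\<pi> (Suc k) = (P @ a # Q @ b # R @ c # T) ! k" if "k < n" for k
    using that unfolding xs[symmetric] by (simp del: upt_Suc)
  have "\<pi> i = a" "\<pi> j = b" "\<pi> m = c"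
    using nth[of "length P"] nth[of "length P + length Q + 1"] nth[of "length P + length Q + length R + 2"]
    by (simp_all add: i_def j_def m_def len nth_append)
  have occ: "occ_1_2_3 n \<pi> = {(i, j, m)}"
  proof (intro equalityI subsetI)
    fix t assume "t \<in> occ_1_2_3 n \<pi>"
    then obtain i' j' m' where t: "t = (i', j', m')" and o: "1 \<le> i'" "i' < j'" "j' < m'" "m' \<le> n"
      "\<pi> i' < \<pi> j'" "\<pi> j' < \<pi> m'"
      by (auto simp: occ_1_2_3_def)
    then have "subseq [\<pi> i', \<pi> j', \<pi> m'] (map \<pi> [1..<Suc n])" unfolding subseq3_map_upt by blast
    then have "\<pi> i' = \<pi> i" "\<pi> j' = \<pi> j" "\<pi> m' = \<pi> m"
      using uniq o \<open>\<pi> i = a\<close> \<open>\<pi> j = b\<close> \<open>\<pi> m = c\<close> by auto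
    \<comment> \<open>Equal values force equal positions, as \<open>\<pi>\<close> is
      injective.\<close>
    then show "t \<in> {(i, j, m)}" using t permutes_inj[OF assms] by (simp add: inj_eq)
  next
    fix t assume "t \<in> {(i, j, m)}"
    then show "t \<in> occ_1_2_3 n \<pi>"
      using abc \<open>\<pi> i = a\<close> \<open>\<pi> j = b\<close> \<open>\<pi> m = c\<close>
      by (auto simp: occ_1_2_3_def i_def j_def m_def len)
  qed
  have "j \<noteq> i + 1" "m \<noteq> j + 1" using ne by (simp_all add: j_def m_def)
  then have "occ_1_23 n \<pi> = {}" "occ_12_3 n \<pi> = {}" using occ by (auto simp: occ_1_23_def occ_12_3_def)
  then show ?l using occ by simp
qed

lemma distinct_split_unique:
  assumes "P @ a # Q = P' @ a # Q'" "distinct (P @ a # Q)"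
  shows "P = P'" "Q = Q'"
proof -
  have "a \<notin> set P" "a \<notin> set Q" using assms(2) by auto
  then show "P = P'" "Q = Q'" using assms(1) append_Cons_eq_iff[of a P Q P' Q'] by blast+
qed

section \<open>Counting the decompositions\<close>

text \<open>The tuple can be read off the word: \<open>a\<close>, \<open>b\<close>, \<open>c\<close>
  form its unique occurrence, and splitting a distinct word at given letters is unambiguous.\<close>

lemma f_num_eq_card_split_perms: "f_num n = card (split_perms n)"
proof -
  define join where "join = (\<lambda>(P, a, Q, b, R, c, T). P @ a # Q @ b # R @ c # T :: nat list)"
  have perm: "join t \<in> permutations_of_set {1..n}" if "t \<in> split_perms n" for t
  proof -
    obtain P a Q b R c T where t: "t = (P, a, Q, b, R, c, T)" by (metis prod_cases7)
    show ?thesis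
      using that unique_occurrence_iff[of P a Q b R c T n] by (simp add: t join_def split_perms_def)
  qed
  have "inj_on join (split_perms n)"
  proof (rule inj_onI)
    fix t t' assume s: "t \<in> split_perms n" "t' \<in> split_perms n" and eq: "join t = join t'"
    obtain P a Q b R c T where t: "t = (P, a, Q, b, R, c, T)" by (metis prod_cases7)
    obtain P' a' Q' b' R' c' T' where t': "t' = (P', a', Q', b', R', c', T')" by (metis prod_cases7)
    have "a < b" "b < c" and uniq: "\<forall>x y z. x < y \<and> y < z \<and> subseq [x, y, z] (join t) \<longrightarrow> x = a \<and> y = b \<and> z = c"
      using s(1) unique_occurrence_iff[of P a Q b R c T n] by (simp_all add: t join_def split_perms_def)
    have "a' < b'" "b' < c'" using s(2) unique_occurrence_iff[of P' a' Q' b' R' c' T' n]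
      by (simp_all add: t' join_def split_perms_def)
    \<comment> \<open>The marked letters of \<open>t'\<close> form an occurrence in the common word,
      so they must be those of \<open>t\<close>.\<close>
    moreover have "subseq [a', b', c'] (join t)" unfolding eq by (simp add: t' join_def subseq_simps)
    ultimately have abc: "a' = a" "b' = b" "c' = c" using uniq by auto
    have d: "distinct (join t)" using perm s by (auto simp: permutations_of_set_def)
    have *: "P @ a # Q @ b # R @ c # T = P' @ a # Q' @ b # R' @ c # T'"
      using eq by (simp add: t t' join_def abc)
    have d: "distinct (P @ a # Q @ b # R @ c # T)" using d by (simp add: t join_def)
    note 1 = distinct_split_unique[OF * d]
    have d: "distinct (Q @ b # R @ c # T)" using d by simp
    note 2 = distinct_split_unique[OF 1(2) d]
    have d: "distinct (R @ c # T)" using d by simp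
    note 3 = distinct_split_unique[OF 2(2) d]
    show "t = t'" using 1 2 3 by (simp add: t t' abc)
  qed
  then have "card (split_perms n) = card (join ` split_perms n)" by (simp add: card_image)
  also have "\<dots> = card {\<pi>. \<pi> permutes {1..n} \<and> map \<pi> [1..<Suc n] \<in> join ` split_perms n}"
  proof (rule bij_betw_same_card[symmetric])
    let ?l = "\<lambda>\<pi>. map \<pi> [1..<Suc n] :: nat list"
    have "?l ` {\<pi>. \<pi> permutes {1..n} \<and> ?l \<pi> \<in> join ` split_perms n} =
        ?l ` {\<pi>. \<pi> permutes {1..n}} \<inter> join ` split_perms n" by blast
    also have "\<dots> = join ` split_perms n"
      using bij_betw_permutes_permutations_of_set[of n] perm by (auto simp: bij_betw_def simp del: upt_Suc)
    finally show "bij_betw ?l {\<pi>. \<pi> permutes {1..n} \<and> ?l \<pi> \<in> join ` split_perms n} (join ` split_perms n)"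
      using bij_betw_permutes_permutations_of_set[of n]
      unfolding bij_betw_def by (auto intro: inj_on_subset)
  qed
  also have "{\<pi>. \<pi> permutes {1..n} \<and> map \<pi> [1..<Suc n] \<in> join ` split_perms n} =
     {\<pi> \<in> perms_with n 1 occ_1_2_3. card (occ_1_23 n \<pi>) = 0 \<and> card (occ_12_3 n \<pi>) = 0}"
  proof (rule Collect_cong)
    fix \<pi> :: "nat \<Rightarrow> nat"
    have "map \<pi> [1..<Suc n] \<in> join ` split_perms n \<longleftrightarrow>
       (\<exists>(P, a, Q, b, R, c, T)\<in>split_perms n. map \<pi> [1..<Suc n] = P @ a # Q @ b # R @ c # T)"
      by (simp add: image_iff join_def case_prod_unfold del: upt_Suc)
    then show "\<pi> permutes {1..n} \<and> map \<pi> [1..<Suc n] \<in> join ` split_perms n \<longleftrightarrow>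
       \<pi> \<in> perms_with n 1 occ_1_2_3 \<and> card (occ_1_23 n \<pi>) = 0 \<and> card (occ_12_3 n \<pi>) = 0"
      using f_num_condition_iff[of \<pi> n] unfolding perms_with_def by blast
  qed
  finally show ?thesis by (simp add: f_num_def)
qed

text \<open>For a fixed middle letter \<open>b\<close> the two halves are chosen independently; as
  minimum of one alphabet and maximum of the other, \<open>b\<close> marks the cut in each.\<close>

lemma card_split_perms:
  "card (split_perms n) = (\<Sum>b=1..n. card (left_halves {b..n}) * card (right_halves {1..b}))"
proof -
  define g where "g = (\<lambda>(P, a, Q, b, R, c, T). (b :: nat, P @ b # Q @ [c], a # R @ b # T :: nat list))"
  have ends: "b \<in> {1..n} \<and> Min {b..n} = b \<and> Max {1..b} = b"
    if "P @ b # Q \<in> avoiders {b..n}" "R @ b # T \<in> avoiders {1..b}" for P Q R T b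
  proof -
    have "b \<in> {b..n}" "b \<in> {1..b}" using that by (auto simp: avoiders_def permutations_of_set_def)
    then show ?thesis by (auto intro!: Min_eqI Max_eqI)
  qed
  have "inj_on g (split_perms n)"
  proof (rule inj_onI)
    fix t t' assume s: "t \<in> split_perms n" "t' \<in> split_perms n" and eq: "g t = g t'"
    obtain P a Q b R c T where t: "t = (P, a, Q, b, R, c, T)" by (metis prod_cases7)
    obtain P' a' Q' b' R' c' T' where t': "t' = (P', a', Q', b', R', c', T')" by (metis prod_cases7)
    have b: "b' = b" and e: "P @ b # Q @ [c] = P' @ b # Q' @ [c']" "(a # R) @ b # T = (a' # R') @ b # T'"
      using eq by (auto simp: t t' g_def)
    have d: "distinct (P @ b # Q @ [c])" "distinct ((a # R) @ b # T)"
      using s by (auto simp: t t' b split_perms_def avoiders_def permutations_of_set_def)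
    show "t = t'"
      using distinct_split_unique[OF e(1) d(1)] distinct_split_unique[OF e(2) d(2)] by (simp add: t t' b)
  qed
  moreover have "g ` split_perms n = (SIGMA b:{1..n}. left_halves {b..n} \<times> right_halves {1..b})"
  proof (intro equalityI subsetI)
    fix u assume "u \<in> g ` split_perms n"
    then obtain P a Q b R c T where s: "(P, a, Q, b, R, c, T) \<in> split_perms n" and u: "u = g (P, a, Q, b, R, c, T)"
      by auto
    then show "u \<in> (SIGMA b:{1..n}. left_halves {b..n} \<times> right_halves {1..b})"
      using ends[of P b "Q @ [c]" "a # R" T]
      by (auto simp: g_def split_perms_def left_halves_def right_halves_def)
  next
    fix u assume "u \<in> (SIGMA b:{1..n}. left_halves {b..n} \<times> right_halves {1..b})"
    then obtain b U V where u: "u = (b, U, V)" and b: "b \<in> {1..n}"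
      and U: "U \<in> left_halves {b..n}" and V: "V \<in> right_halves {1..b}" by blast
    have m: "Min {b..n} = b" "Max {1..b} = b" using b by (auto intro!: Min_eqI Max_eqI)
    obtain P Q c where U': "U = P @ b # Q @ [c]" "Q \<noteq> []" using U m unfolding left_halves_def by auto
    obtain a R T where V': "V = a # R @ b # T" "R \<noteq> []" using V m unfolding right_halves_def by auto
    have "(P, a, Q, b, R, c, T) \<in> split_perms n"
      using U V U' V' by (auto simp: split_perms_def left_halves_def right_halves_def)
    then show "u \<in> g ` split_perms n"
      by (rule rev_image_eqI) (simp add: g_def u U' V')
  qed
  ultimately have "card (split_perms n) = card (SIGMA b:{1..n}. left_halves {b..n} \<times> right_halves {1..b})"
    by (metis card_image)
  also have "\<dots> = (\<Sum>b=1..n. card (left_halves {b..n} \<times> right_halves {1..b}))"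
    by (rule card_SigmaI) (auto simp: left_halves_def right_halves_def)
  finally show ?thesis by (simp add: card_cartesian_product)
qed

lemma f_num_eq_nth: "real (f_num n) = fps_nth (fps_X ^ 5 * catalan_fps ^ 8) n"
proof -
  let ?h = "fps_X ^ 3 * catalan_fps ^ 4"
  \<comment> \<open>The halves have \<open>n + 1 - b\<close> and \<open>b\<close> letters; counting
    \<open>b\<close> twice makes the sizes add up to \<open>n + 1\<close>.\<close>
  have "real (f_num n) = (\<Sum>b=1..n. fps_nth ?h b * fps_nth ?h (Suc n - b))"
    unfolding f_num_eq_card_split_perms card_split_perms of_nat_sum
    by (rule sum.cong) (auto simp: card_left_halves card_right_halves mult.commute simp del: fps_X_power_mult_nth)
  \<comment> \<open>Both added terms contain the vanishing coefficient of \<open>?h\<close> at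
    0.\<close>
  also have "\<dots> = (\<Sum>b=0..Suc n. fps_nth ?h b * fps_nth ?h (Suc n - b))"
    by (rule sum.mono_neutral_left) (auto simp: half_fps_nth)
  also have "\<dots> = fps_nth (?h * ?h) (Suc n)" by (rule fps_mult_nth[symmetric])
  also have "?h * ?h = fps_X * (fps_X ^ 5 * catalan_fps ^ 8)"
    by (simp add: algebra_simps flip: power_add power_Suc)
  finally show ?thesis by simp
qed

section \<open>Binomial coefficients of Catalan powers and the final series\<close>

text \<open>The ballot formula k/(2n+k) binom(2n+k, n), shifted to index \<open>Suc n\<close> so
  that the denominator is free of \<open>k\<close>. The ballot recursion proves it by an outer
  induction on \<open>n\<close> for all \<open>k\<close> and an inner one on
  \<open>k\<close>.\<close>

lemma catalan_power_nth_Suc: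
  "fps_nth (catalan_fps ^ k) (Suc n) = real k / (real n + 1) * real ((2 * n + k + 1) choose n)"
proof (induction n arbitrary: k)
  case 0
  show ?case
  proof (induction k)
    case (Suc k)
    then show ?case
      unfolding catalan_power_Suc_nth by (simp add: catalan_nth_0 del: power_Suc)
  qed simp
next
  case (Suc m)
  note outer = Suc.IH
  show ?case
  proof (induction k)
    case (Suc k)
    \<comment> \<open>The common upper entry of both binomials on the right of the recursion; after
      Pascal's rule and \<open>rel\<close> only \<open>N choose m\<close> remains.\<close>
    define N where "N = 2 * m + k + 3"
    have N: "2 * Suc m + k + 1 = N" "2 * m + (k + 2) + 1 = N" "2 * Suc m + Suc k + 1 = Suc N"
      "Suc (m + (m + k + 2)) = N" by (simp_all add: N_def)
    have "real (Suc m) * real (N choose Suc m) = real (Suc (m + k + 2)) * real (N choose m)"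
      using Suc_times_binomial_add[of m "m + k + 2"] unfolding N by (metis of_nat_mult)
    then have rel: "real (N choose Suc m) = (real m + real k + 3) / (real m + 1) * real (N choose m)"
      by (simp add: field_simps)
    show ?case
      unfolding catalan_power_Suc_nth Suc.IH outer N binomial_Suc_Suc of_nat_add rel
      by (simp add: divide_simps) algebra
  qed simp
qed

theorem theorem11:
  shows "Abs_fps (\<lambda>n. if n \<ge> 5 then real (f_num n) else 0) = fps_X ^ 5 * catalan_fps ^ 8 \<and>
         fps_X ^ 5 * catalan_fps ^ 8 =
           Abs_fps (\<lambda>n. if n \<ge> 5
             then 8 / (real n + 3) * real ((2 * n - 3) choose (n + 2)) else 0)"
proof
  show "Abs_fps (\<lambda>n. if n \<ge> 5 then real (f_num n) else 0) = fps_X ^ 5 * catalan_fps ^ 8"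
    by (rule fps_ext) (simp add: f_num_eq_nth fps_X_power_mult_nth)
  show "fps_X ^ 5 * catalan_fps ^ 8 = Abs_fps (\<lambda>n. if n \<ge> 5
             then 8 / (real n + 3) * real ((2 * n - 3) choose (n + 2)) else 0)"
  proof (rule fps_ext)
    fix n
    \<comment> \<open>The value \<open>n = 5\<close> stands apart because the ballot formula covers
      only positive indices of C^8.\<close>
    consider "n < 5" | "n = 5" | m where "n = Suc m + 5" by (metis add.commute less_Suc_eq less_imp_add_positive linorder_less_linear not0_implies_Suc not_gr_zero)
    then show "fps_nth (fps_X ^ 5 * catalan_fps ^ 8) n =
      fps_nth (Abs_fps (\<lambda>n. if n \<ge> 5 then 8 / (real n + 3) * real ((2 * n - 3) choose (n + 2)) else 0)) n"
    proof cases
      case (3 m)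
      \<comment> \<open>Symmetry turns the lower entry \<open>n + 2\<close> into
        \<open>n - 5 = Suc m\<close>; the absorption identity that follows then produces the factor
        \<open>m + 9 = n + 3\<close>.\<close>
      have "(2 * n - 3) choose (n + 2) = Suc (m + (m + 8)) choose Suc m"
        using binomial_symmetric[of "n + 2" "2 * n - 3"] by (simp add: 3)
      moreover have "real (Suc (m + (m + 8)) choose Suc m)
          = (real m + 9) / (real m + 1) * real (Suc (m + (m + 8)) choose m)"
        using arg_cong[OF Suc_times_binomial_add[of m "m + 8"], of real] by (simp add: field_simps)
      moreover have "fps_nth (fps_X ^ 5 * catalan_fps ^ 8) n = fps_nth (catalan_fps ^ 8) (Suc m)"
        by (simp add: 3 fps_X_power_mult_nth)
      moreover have "2 * m + 8 + 1 = Suc (m + (m + 8))" by simp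
      ultimately show ?thesis
        unfolding catalan_power_nth_Suc fps_nth_Abs_fps by (simp add: 3 add_ac)
    qed (simp_all add: fps_X_power_mult_nth catalan_nth_0)
  qed
qed

end
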